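(* Let $\lambda\in\mathbb{R}$, let $A=\begin{pmatrix}\lambda&1\\ 0&\lambda\end{pmatrix}$, and let $T:\mathbb{R}^2\to\mathbb{R}^2$, $Tx=Ax$. Then: (i) for every $\lambda$ and every $x^*=\begin{pmatrix}x_1^*\\ x_2^*\end{pmatrix}$ with $x_1^*x_2^*\neq0$, $T$ is weakly transitive for $x^*$ in weak topology; (ii) for every $\lambda$, $T$ is not strongly transitive in weak topology.
   Context: Let $\mathbb{N}=\{1,2,3,\dots\}$. Continuous linear functionals on $\mathbb{R}^2$ are identified with vectors $x^*\in\mathbb{R}^2$ via $\langle x,x^*\rangle=x_1x_1^*+x_2x_2^*$, and $p_{x^*}(x)=|\langle x,x^*\rangle|$. For a nonzero $x^*$, a map $T:\mathbb{R}^2\to\mathbb{R}^2$ is weakly transitive for $x^*$ in weak topology if for all $x,y\in\mathbb{R}^2$ and $\varepsilon>0$ there exist $n\in\mathbb{N}$ and $z\in\mathbb{R}^2$ with $p_{x^*}(z-x)<\varepsilon$ and $p_{x^*}(T^nz-y)<\varepsilon$. $T$ is weakly transitive in weak topology if this holds for some nonzero $x^*$, and strongly transitive in weak topology if it holds for every nonzero $x^*$. *)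

theory Defs
  imports "HOL-Analysis.Analysis"
begin

text \<open>
  A continuous linear functional on the plane is identified with the vector \<open>xs\<close> representing it
  through the inner product.
\<close>

definition functional_seminorm :: "real^2 \<Rightarrow> real^2 \<Rightarrow> real" where
  "functional_seminorm xs x = \<bar>x \<bullet> xs\<bar>"

text \<open>Intended for nonzero \<open>xs\<close>; the two notions below impose this condition on the functional.\<close>

definition weakly_transitive_for :: "(real^2 \<Rightarrow> real^2) \<Rightarrow> real^2 \<Rightarrow> bool" where
  "weakly_transitive_for T xs \<longleftrightarrow>
     (\<forall>x y. \<forall>\<epsilon>>0. \<exists>n\<ge>1. \<exists>z. functional_seminorm xs (z - x) < \<epsilon> \<and>
                             functional_seminorm xs ((T ^^ n) z - y) < \<epsilon>)"

definition weakly_transitive :: "(real^2 \<Rightarrow> real^2) \<Rightarrow> bool" where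
  "weakly_transitive T \<longleftrightarrow> (\<exists>xs. xs \<noteq> 0 \<and> weakly_transitive_for T xs)"

definition strongly_transitive :: "(real^2 \<Rightarrow> real^2) \<Rightarrow> bool" where
  "strongly_transitive T \<longleftrightarrow> (\<forall>xs. xs \<noteq> 0 \<longrightarrow> weakly_transitive_for T xs)"

definition jordan_matrix2 :: "real \<Rightarrow> real^2^2" where
  "jordan_matrix2 c = vector [vector [c, 1], vector [0, c]]"

end

theory Submission
  imports Defs
begin

text \<open>
  What matters is how the functional \<open>xs = (p, q)\<close> behaves under the transpose of \<open>A\<close>.

  If \<open>p \<noteq> 0\<close>, then \<open>xs\<close> is a cyclic vector of the transpose of \<open>A\<close>: the functionals
  \<open>z \<mapsto> z \<bullet> xs\<close> and \<open>z \<mapsto> (A *v z) \<bullet> xs\<close> are given by \<open>(p, q)\<close> and \<open>(c p, p + c q)\<close>, whose determinant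
  is \<open>p\<^sup>2\<close>.  Hence their values can be prescribed independently, and already \<open>n = 1\<close> hits both
  targets exactly.

  The second coordinate functional, on the contrary, is an eigenvector of the transpose of \<open>A\<close>.
  Through it one sees only the scalar map \<open>s \<mapsto> c s\<close>, which is not transitive on the line: if
  \<open>\<bar>c\<bar> \<le> 1\<close> no orbit moves away from \<open>0\<close>, and if \<open>\<bar>c\<bar> > 1\<close> none moves towards \<open>0\<close>.
\<close>

lemma jordan_matrix2_mult_nth:
  "(jordan_matrix2 c *v z) $ 1 = c * z $ 1 + z $ 2"
  "(jordan_matrix2 c *v z) $ 2 = c * z $ 2"
  by (simp_all add: jordan_matrix2_def matrix_vector_mult_def sum_2)

lemma jordan_matrix2_power_nth_2:
  "(((*v) (jordan_matrix2 c) ^^ n) z) $ 2 = c ^ n * z $ 2"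
  by (induction n) (simp_all add: jordan_matrix2_mult_nth)

lemma inner_real2: "(x :: real^2) \<bullet> y = x $ 1 * y $ 1 + x $ 2 * y $ 2"
  by (simp add: inner_vec_def sum_2)

lemma jordan_matrix2_prescribed_values:
  fixes xs :: "real^2"
  assumes "xs $ 1 \<noteq> 0"
  obtains z where "z \<bullet> xs = s" "(jordan_matrix2 c *v z) \<bullet> xs = t"
proof -
  \<comment> \<open>Since \<open>(A *v z) \<bullet> xs = c * (z \<bullet> xs) + z $ 2 * xs $ 1\<close>, the two targets determine \<open>z $ 2\<close> first.\<close>
  define b where "b = (t - c * s) / xs $ 1"
  define z :: "real^2" where "z = vector [(s - b * xs $ 2) / xs $ 1, b]"
  have first: "z \<bullet> xs = s"
    using assms by (simp add: z_def inner_real2)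
  have "(jordan_matrix2 c *v z) \<bullet> xs = c * (z \<bullet> xs) + z $ 2 * xs $ 1"
    by (simp add: inner_real2 jordan_matrix2_mult_nth algebra_simps)
  also have "\<dots> = t"
    using assms unfolding first by (simp add: z_def b_def)
  finally show thesis
    using first that by blast
qed

lemma jordan_matrix2_weakly_transitive_for:
  assumes "xs $ 1 \<noteq> 0"
  shows "weakly_transitive_for ((*v) (jordan_matrix2 c)) xs"
  unfolding weakly_transitive_for_def
proof (intro allI impI)
  fix x y :: "real^2" and \<epsilon> :: real
  assume "\<epsilon> > 0"
  obtain z where "z \<bullet> xs = x \<bullet> xs" "(jordan_matrix2 c *v z) \<bullet> xs = y \<bullet> xs"
    using jordan_matrix2_prescribed_values[OF assms] .
  with \<open>\<epsilon> > 0\<close> show "\<exists>n\<ge>1. \<exists>z. functional_seminorm xs (z - x) < \<epsilon> \<and>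
      functional_seminorm xs (((*v) (jordan_matrix2 c) ^^ n) z - y) < \<epsilon>"
    by (intro exI[of _ 1] conjI exI[of _ z])
       (simp_all add: functional_seminorm_def inner_diff_left)
qed

lemma functional_seminorm_axis_2: "functional_seminorm (axis 2 1) x = \<bar>x $ 2\<bar>"
  by (simp add: functional_seminorm_def inner_axis)

text \<open>
  The powers of \<open>c\<close> either all have modulus at most \<open>1\<close> or all have modulus at least \<open>1\<close>.  In the
  first case no point near \<open>0\<close> is ever sent near \<open>1\<close>, in the second no point near \<open>1\<close> is ever sent
  near \<open>0\<close>.
\<close>

lemma jordan_matrix2_not_weakly_transitive_for_axis_2:
  "\<not> weakly_transitive_for ((*v) (jordan_matrix2 c)) (axis 2 1)"
proof
  assume "weakly_transitive_for ((*v) (jordan_matrix2 c)) (axis 2 1)"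
  then have approx: "\<exists>n u. \<bar>u - x $ 2\<bar> < 1/2 \<and> \<bar>c ^ n * u - y $ 2\<bar> < 1/2" for x y :: "real^2"
    unfolding weakly_transitive_for_def functional_seminorm_axis_2
    by (metis jordan_matrix2_power_nth_2 vector_minus_component zero_less_divide_1_iff
        zero_less_numeral)
  show False
  proof (cases "\<bar>c\<bar> \<le> 1")
    case True
    obtain n u where u: "\<bar>u\<bar> < 1/2" "\<bar>c ^ n * u - 1\<bar> < 1/2"
      using approx[of 0 1] by auto
    have "\<bar>c\<bar> ^ n \<le> 1"
      using True by (simp add: power_le_one)
    then have "\<bar>c ^ n * u\<bar> \<le> \<bar>u\<bar>"
      by (simp add: abs_mult power_abs mult_left_le_one_le)
    with u show False
      by linarith
  next
    case False
    obtain n u where u: "\<bar>u - 1\<bar> < 1/2" "\<bar>c ^ n * u\<bar> < 1/2"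
      using approx[of 1 0] by auto
    have "1 \<le> \<bar>c\<bar> ^ n"
      using False by (simp add: one_le_power)
    then have "1 * \<bar>u\<bar> \<le> \<bar>c\<bar> ^ n * \<bar>u\<bar>"
      by (rule mult_right_mono) simp
    then have "\<bar>u\<bar> \<le> \<bar>c ^ n * u\<bar>"
      by (simp add: abs_mult power_abs)
    with u show False
      by linarith
  qed
qed

theorem theorem3p2:
  fixes c :: real and A :: "real^2^2" and T :: "real^2 \<Rightarrow> real^2"
  assumes "A = jordan_matrix2 c"
    and "T = (\<lambda>x. A *v x)"
  shows "(\<forall>xs :: real^2. xs $ 1 * xs $ 2 \<noteq> 0 \<longrightarrow> weakly_transitive_for T xs) \<and>
         \<not> strongly_transitive T"
proof (intro conjI allI impI)
  have T: "T = (*v) (jordan_matrix2 c)"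
    using assms by simp
  show "weakly_transitive_for T xs" if "xs $ 1 * xs $ 2 \<noteq> 0" for xs
    using that jordan_matrix2_weakly_transitive_for by (simp add: T)
  have "axis 2 1 \<noteq> (0 :: real^2)"
    by (simp add: axis_eq_0_iff)
  then show "\<not> strongly_transitive T"
    unfolding strongly_transitive_def T
    using jordan_matrix2_not_weakly_transitive_for_axis_2 by blast
qed

end
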